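(* Let $H$ be a connected graph with at least one edge. Then for every graph $G$, $\mathrm{cover}_H(G)\leq \omega_H(\mathrm{tpw}(G))\cdot \mathrm{pack}_H(G)$, where $\omega_H(r)=\left\lceil r\cdot\frac{3r+1}{2}\cdot|E(H)|\right\rceil$.
   Context: Graphs are finite, loopless, may have multiple edges; $|E(H)|$ counts multiplicities. $G$ contains $H$ as an immersion if there is $(\phi,\psi)$ with $\phi:V(H)\to V(G)$ injective and $\psi$ mapping each edge of $H$ (each copy of a multiple edge separately) with endpoints $u,v$ to a path of $G$ between $\phi(u),\phi(v)$, distinct edges going to edge-disjoint paths; the $H$-immersion expansion is the subgraph formed by $\phi(V(H))$ and the vertices and edges of these paths. $\mathrm{pack}_H(G)$ is the maximum number of pairwise edge-disjoint $H$-immersion expansions in $G$; $\mathrm{cover}_H(G)$ is the minimum size of $C\subseteq E(G)$ such that $G\setminus C$ does not contain $H$ as an immersion. A tree-partition of $G$ is a pair $(T,\{X_t\}_{t\in V(T)})$ with $T$ a tree and $\{X_t\}$ a partition of $V(G)$ such that either $|V(T)|=1$ or every edge of $G$ has both endpoints in $X_t\cup X_{t'}$ for some edge $\{t,t'\}$ of $T$. Its width is the maximum of all $|X_t|$ and all $|E_f|$, where for $f=\{t,t'\}\in E(T)$, $E_f$ is the set of edges (with multiplicity) with one endpoint in $X_t$ and the other in $X_{t'}$. $\mathrm{tpw}(G)$ is the minimum width of a tree-partition of $G$. *)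

theory Defs
  imports Complex_Main "HOL-Library.Disjoint_Sets"
begin

section \<open>Finite loopless multigraphs\<close>

text \<open>
  Edges are named objects and \<open>ends\<close> gives the two endpoints of an edge, so parallel edges are
  distinct elements of \<open>edges\<close> and cardinalities of edge sets count multiplicities.
\<close>

record ('v, 'e) mgraph =
  verts :: "'v set"
  edges :: "'e set"
  ends :: "'e \<Rightarrow> 'v set"

definition multigraph :: "('v, 'e) mgraph \<Rightarrow> bool" where
  "multigraph G \<longleftrightarrow> finite (verts G) \<and> finite (edges G) \<and>
     (\<forall>e\<in>edges G. ends G e \<subseteq> verts G \<and> card (ends G e) = 2)"

definition delete_edges :: "('v, 'e) mgraph \<Rightarrow> 'e set \<Rightarrow> ('v, 'e) mgraph" where
  "delete_edges G C = G\<lparr>edges := edges G - C\<rparr>"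

text \<open>A path is given by its sequence of vertices and its sequence of edges.\<close>

definition path_between :: "('v, 'e) mgraph \<Rightarrow> 'v \<Rightarrow> 'v list \<times> 'e list \<Rightarrow> 'v \<Rightarrow> bool" where
  "path_between G u p v \<longleftrightarrow> (case p of (vs, es) \<Rightarrow>
     length vs = length es + 1 \<and> hd vs = u \<and> last vs = v \<and>
     distinct vs \<and> set vs \<subseteq> verts G \<and> set es \<subseteq> edges G \<and>
     (\<forall>i<length es. ends G (es ! i) = {vs ! i, vs ! (i + 1)}))"

definition path_verts :: "'v list \<times> 'e list \<Rightarrow> 'v set" where
  "path_verts p = set (fst p)"

definition path_edges :: "'v list \<times> 'e list \<Rightarrow> 'e set" where
  "path_edges p = set (snd p)"

definition connected_graph :: "('v, 'e) mgraph \<Rightarrow> bool" where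
  "connected_graph G \<longleftrightarrow> verts G \<noteq> {} \<and>
     (\<forall>u\<in>verts G. \<forall>v\<in>verts G. \<exists>p. path_between G u p v)"

text \<open>Two parallel edges form a cycle of length 2.\<close>

definition is_cycle :: "('v, 'e) mgraph \<Rightarrow> 'v list \<Rightarrow> 'e list \<Rightarrow> bool" where
  "is_cycle G vs es \<longleftrightarrow> length vs = length es \<and> 2 \<le> length es \<and>
     distinct vs \<and> distinct es \<and> set vs \<subseteq> verts G \<and> set es \<subseteq> edges G \<and>
     (\<forall>i<length es. ends G (es ! i) = {vs ! i, vs ! ((i + 1) mod length es)})"

definition is_tree :: "('v, 'e) mgraph \<Rightarrow> bool" where
  "is_tree T \<longleftrightarrow> multigraph T \<and> connected_graph T \<and> (\<nexists>vs es. is_cycle T vs es)"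

section \<open>Immersions, packing and covering\<close>

definition is_immersion ::
  "('a, 'b) mgraph \<Rightarrow> ('v, 'e) mgraph \<Rightarrow> ('a \<Rightarrow> 'v) \<Rightarrow> ('b \<Rightarrow> 'v list \<times> 'e list) \<Rightarrow> bool" where
  "is_immersion H G \<phi> \<psi> \<longleftrightarrow>
     \<phi> ` verts H \<subseteq> verts G \<and> inj_on \<phi> (verts H) \<and>
     (\<forall>e\<in>edges H. \<exists>u v. ends H e = {u, v} \<and> path_between G (\<phi> u) (\<psi> e) (\<phi> v)) \<and>
     (\<forall>e\<in>edges H. \<forall>f\<in>edges H. e \<noteq> f \<longrightarrow> path_edges (\<psi> e) \<inter> path_edges (\<psi> f) = {})"

definition contains_immersion :: "('v, 'e) mgraph \<Rightarrow> ('a, 'b) mgraph \<Rightarrow> bool" where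
  "contains_immersion G H \<longleftrightarrow> (\<exists>\<phi> \<psi>. is_immersion H G \<phi> \<psi>)"

definition expansion_of ::
  "('a, 'b) mgraph \<Rightarrow> ('v, 'e) mgraph \<Rightarrow> ('a \<Rightarrow> 'v) \<Rightarrow> ('b \<Rightarrow> 'v list \<times> 'e list) \<Rightarrow> ('v, 'e) mgraph"
  where
  "expansion_of H G \<phi> \<psi> =
     G\<lparr>verts := \<phi> ` verts H \<union> (\<Union>e\<in>edges H. path_verts (\<psi> e)),
       edges := (\<Union>e\<in>edges H. path_edges (\<psi> e))\<rparr>"

definition immersion_expansions :: "('a, 'b) mgraph \<Rightarrow> ('v, 'e) mgraph \<Rightarrow> ('v, 'e) mgraph set" where
  "immersion_expansions H G = {expansion_of H G \<phi> \<psi> |\<phi> \<psi>. is_immersion H G \<phi> \<psi>}"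

text \<open>
  All expansions share the incidence function of \<open>G\<close>, so a finite \<open>G\<close> has only finitely many and
  the maximum exists. If \<open>H\<close> has an edge, every expansion has an edge; edge-disjoint expansions are
  then distinct, and counting a set of them is the same as counting a family.
\<close>

definition pack :: "('a, 'b) mgraph \<Rightarrow> ('v, 'e) mgraph \<Rightarrow> nat" where
  "pack H G = Max {card \<S> |\<S>. \<S> \<subseteq> immersion_expansions H G \<and>
     (\<forall>S\<in>\<S>. \<forall>S'\<in>\<S>. S \<noteq> S' \<longrightarrow> edges S \<inter> edges S' = {})}"

text \<open>
  If \<open>H\<close> has an edge, the set \<open>C = edges G\<close> is always admissible, so the minimum exists.
\<close>

definition cover :: "('a, 'b) mgraph \<Rightarrow> ('v, 'e) mgraph \<Rightarrow> nat" where
  "cover H G = (LEAST k. \<exists>C. C \<subseteq> edges G \<and> card C = k \<and>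
     \<not> contains_immersion (delete_edges G C) H)"

section \<open>Tree-partitions\<close>

text \<open>
  The bags are an indexed family of pairwise disjoint sets with union \<open>verts G\<close>. Empty bags are
  allowed; this does not affect the minimum width, and gives the graph without vertices a
  tree-partition (with a single empty bag).
\<close>

definition tree_partition ::
  "('v, 'e) mgraph \<Rightarrow> ('n, 'f) mgraph \<Rightarrow> ('n \<Rightarrow> 'v set) \<Rightarrow> bool" where
  "tree_partition G T X \<longleftrightarrow> is_tree T \<and>
     (\<Union>t\<in>verts T. X t) = verts G \<and> disjoint_family_on X (verts T) \<and>
     (card (verts T) = 1 \<or>
      (\<forall>e\<in>edges G. \<exists>f\<in>edges T. \<exists>t t'. ends T f = {t, t'} \<and> ends G e \<subseteq> X t \<union> X t'))"

definition cross_edges ::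
  "('v, 'e) mgraph \<Rightarrow> ('n, 'f) mgraph \<Rightarrow> ('n \<Rightarrow> 'v set) \<Rightarrow> 'f \<Rightarrow> 'e set" where
  "cross_edges G T X f =
     {e \<in> edges G. \<exists>t t' u v. ends T f = {t, t'} \<and> ends G e = {u, v} \<and> u \<in> X t \<and> v \<in> X t'}"

definition tp_width ::
  "('v, 'e) mgraph \<Rightarrow> ('n, 'f) mgraph \<Rightarrow> ('n \<Rightarrow> 'v set) \<Rightarrow> nat" where
  "tp_width G T X =
     Max ((\<lambda>t. card (X t)) ` verts T \<union> (\<lambda>f. card (cross_edges G T X f)) ` edges T)"

text \<open>
  Trees are finite, so up to isomorphism it suffices to consider trees whose nodes and edges are
  natural numbers.
\<close>

definition tpw :: "('v, 'e) mgraph \<Rightarrow> nat" where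
  "tpw G = (LEAST w. \<exists>(T :: (nat, nat) mgraph) X. tree_partition G T X \<and> tp_width G T X = w)"

definition omega :: "('a, 'b) mgraph \<Rightarrow> nat \<Rightarrow> int" where
  "omega H r = \<lceil>real r * ((3 * real r + 1) / 2) * real (card (edges H))\<rceil>"

end

theory Submission
  imports Defs
begin

text \<open>
  Root an optimal tree-partition, of width \<open>r\<close>, and let \<open>t\<close> be a deepest node such that the part of
  \<open>G\<close> in the bags below \<open>t\<close> contains \<open>H\<close>. Fix an expansion \<open>M\<close> there, and let \<open>C\<close> consist of the
  edges of \<open>M\<close> inside the bag \<open>X t\<close> together with all edges joining \<open>X t\<close> to a child branch that \<open>M\<close>
  meets. A path of \<open>M\<close> visits \<open>X t\<close> at most \<open>r\<close> times, so it contributes at most \<open>r + 1\<close> bag edges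
  and branches, each of cost at most \<open>r\<close>; hence \<open>|C| \<le> r (r + 1) |E(H)|\<close>, which is at most
  \<open>\<omega>\<^sub>H(r)\<close>. An expansion in \<open>G - C\<close> sharing an edge with \<open>M\<close> would, by connectedness, lie inside a
  single child branch, against the choice of \<open>t\<close>. So deleting \<open>C\<close> decreases the packing number, and
  the bound follows by induction on it.
\<close>

section \<open>Induced subgraphs, edge cuts and edge deletion\<close>

definition induced_subgraph :: "('v, 'e) mgraph \<Rightarrow> 'v set \<Rightarrow> ('v, 'e) mgraph" where
  "induced_subgraph G W = G\<lparr>verts := verts G \<inter> W, edges := {e \<in> edges G. ends G e \<subseteq> W}\<rparr>"

text \<open>In a \<open>multigraph\<close> this is the usual edge cut of \<open>D\<close>.\<close>

definition boundary :: "('v, 'e) mgraph \<Rightarrow> 'v set \<Rightarrow> 'e set" where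
  "boundary G D = {e \<in> edges G. ends G e \<inter> D \<noteq> {} \<and> \<not> ends G e \<subseteq> D}"

lemma induced_subgraph_simps [simp]:
  "verts (induced_subgraph G W) = verts G \<inter> W"
  "edges (induced_subgraph G W) = {e \<in> edges G. ends G e \<subseteq> W}"
  "ends (induced_subgraph G W) = ends G"
  by (simp_all add: induced_subgraph_def)

lemma delete_edges_simps [simp]:
  "verts (delete_edges G C) = verts G"
  "edges (delete_edges G C) = edges G - C"
  "ends (delete_edges G C) = ends G"
  by (simp_all add: delete_edges_def)

lemma delete_edges_empty [simp]: "delete_edges G {} = G"
  by (simp add: delete_edges_def)

lemma delete_edges_delete_edges [simp]:
  "delete_edges (delete_edges G C) C' = delete_edges G (C \<union> C')"
proof -
  have "edges G - C - C' = edges G - (C \<union> C')" by blast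
  then show ?thesis by (simp add: delete_edges_def)
qed

lemma multigraph_delete_edges: "multigraph G \<Longrightarrow> multigraph (delete_edges G C)"
  by (auto simp: multigraph_def)

section \<open>Paths and immersions\<close>

lemma path_verts_nth:
  assumes "length vs = length es + 1"
  shows "path_verts (vs, es) = (\<lambda>i. vs ! i) ` {..length es}"
  using assms by (auto simp: path_verts_def in_set_conv_nth image_iff less_Suc_eq_le)

lemma path_between_edge_ends:
  assumes "path_between G u p v" "e \<in> path_edges p"
  shows "ends G e \<subseteq> path_verts p" "e \<in> edges G"
proof -
  obtain vs es where p: "p = (vs, es)" by (cases p)
  obtain i where "i < length es" "e = es ! i"
    using assms(2) by (auto simp: p path_edges_def in_set_conv_nth)
  with assms(1) show "ends G e \<subseteq> path_verts p"
    by (auto simp: p path_between_def path_verts_def)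
  show "e \<in> edges G"
    using assms by (auto simp: p path_between_def path_edges_def)
qed

lemma path_between_in_verts:
  assumes "path_between G u p v"
  shows "u \<in> path_verts p" "v \<in> path_verts p" "path_verts p \<subseteq> verts G"
proof -
  obtain vs es where p: "p = (vs, es)" by (cases p)
  have "vs \<noteq> []" using assms by (auto simp: p path_between_def)
  then show "u \<in> path_verts p" "v \<in> path_verts p" "path_verts p \<subseteq> verts G"
    using assms by (auto simp: p path_between_def path_verts_def)
qed

lemma path_between_transfer:
  assumes "path_between G u p v" "path_verts p \<subseteq> verts G'" "path_edges p \<subseteq> edges G'"
    "ends G' = ends G"
  shows "path_between G' u p v"
  using assms by (auto simp: path_between_def path_verts_def path_edges_def split: prod.splits)

text \<open>Walking along a path, membership in \<open>D\<close> can change only across an edge of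
  the cut of \<open>D\<close>.\<close>

lemma path_within_side:
  assumes p: "path_between G u p v" and meets: "path_verts p \<inter> D \<noteq> {}"
    and nb: "path_edges p \<inter> boundary G D = {}"
  shows "path_verts p \<subseteq> D"
proof -
  obtain vs es where vs: "p = (vs, es)" by (cases p)
  have len: "length vs = length es + 1" using p by (simp add: vs path_between_def)
  have step: "vs ! i \<in> D \<longleftrightarrow> vs ! Suc i \<in> D" if "i < length es" for i
  proof -
    have "es ! i \<in> edges G" "ends G (es ! i) = {vs ! i, vs ! Suc i}"
      using p that by (auto simp: vs path_between_def)
    moreover have "es ! i \<notin> boundary G D"
      using nb nth_mem[OF that] by (auto simp: vs path_edges_def)
    ultimately show ?thesis by (auto simp: boundary_def)
  qed
  have all: "vs ! i \<in> D \<longleftrightarrow> vs ! 0 \<in> D" if "i \<le> length es" for i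
    using that by (induction i) (auto simp: step)
  then show ?thesis
    using meets unfolding vs path_verts_nth[OF len] by auto
qed

lemma is_immersion_path:
  assumes "is_immersion H G \<phi> \<psi>" "e \<in> edges H"
  obtains u v where "ends H e = {u, v}" "path_between G (\<phi> u) (\<psi> e) (\<phi> v)"
  using assms by (auto simp: is_immersion_def)

text \<open>Injectivity and edge-disjointness do not mention the host graph, so only the location of
  images and paths has to be rechecked. Serves both for passing to a supergraph and for restricting
  to an induced subgraph.\<close>

lemma is_immersion_transfer:
  assumes "is_immersion H G \<phi> \<psi>" "\<phi> ` verts H \<subseteq> verts G'" "ends G' = ends G"
    "\<And>e. e \<in> edges H \<Longrightarrow> path_verts (\<psi> e) \<subseteq> verts G'"
    "\<And>e. e \<in> edges H \<Longrightarrow> path_edges (\<psi> e) \<subseteq> edges G'"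
  shows "is_immersion H G' \<phi> \<psi>"
  unfolding is_immersion_def
proof (intro conjI ballI)
  fix e assume e: "e \<in> edges H"
  obtain u v where "ends H e = {u, v}" "path_between G (\<phi> u) (\<psi> e) (\<phi> v)"
    using is_immersion_path[OF assms(1) e] .
  then show "\<exists>u v. ends H e = {u, v} \<and> path_between G' (\<phi> u) (\<psi> e) (\<phi> v)"
    using path_between_transfer assms(3-5) e by metis
qed (use assms in \<open>auto simp: is_immersion_def\<close>)

lemma is_immersion_mono:
  assumes "is_immersion H G \<phi> \<psi>" "verts G \<subseteq> verts G'" "edges G \<subseteq> edges G'" "ends G' = ends G"
  shows "is_immersion H G' \<phi> \<psi>"
proof (rule is_immersion_transfer[OF assms(1)])
  show "\<phi> ` verts H \<subseteq> verts G'" using assms by (auto simp: is_immersion_def)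
  fix e assume e: "e \<in> edges H"
  obtain u v where p: "path_between G (\<phi> u) (\<psi> e) (\<phi> v)"
    using is_immersion_path[OF assms(1) e] .
  show "path_verts (\<psi> e) \<subseteq> verts G'" "path_edges (\<psi> e) \<subseteq> edges G'"
    using path_between_in_verts(3)[OF p] path_between_edge_ends(2)[OF p] assms by auto
qed (use assms in auto)

text \<open>Each path of the immersion lies entirely in \<open>D\<close> or misses it. Hence no edge
  of \<open>H\<close> joins a vertex mapped into \<open>D\<close> to one mapped outside, and
  connectedness of \<open>H\<close> spreads the one path meeting \<open>D\<close> to the whole
  immersion.\<close>

lemma immersion_within_side:
  assumes H: "connected_graph H" "multigraph H" and imm: "is_immersion H G \<phi> \<psi>"
    and e0: "e0 \<in> edges H" "path_verts (\<psi> e0) \<inter> D \<noteq> {}"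
    and nb: "\<And>e. e \<in> edges H \<Longrightarrow> path_edges (\<psi> e) \<inter> boundary G D = {}"
  shows "is_immersion H (induced_subgraph G D) \<phi> \<psi>"
proof -
  define S where "S = {u. \<phi> u \<in> D}"
  have side: "path_verts (\<psi> e) \<subseteq> D" if "e \<in> edges H" "path_verts (\<psi> e) \<inter> D \<noteq> {}" for e
    using is_immersion_path[OF imm that(1)] path_within_side nb that by metis
  have ends_sub: "\<phi> ` ends H e \<subseteq> path_verts (\<psi> e)" if e: "e \<in> edges H" for e
    using is_immersion_path[OF imm e] path_between_in_verts(1,2) by (metis image_empty image_insert
      empty_subsetI insert_subset)
  \<comment> \<open>The path of an edge of \<open>H\<close> with an end in \<open>S\<close> meets
    \<open>D\<close>, so it lies in \<open>D\<close> and the other end is in \<open>S\<close>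
    too.\<close>
  have "boundary H S = {}"
    using side ends_sub unfolding boundary_def S_def by blast
  obtain u0 v0 where "ends H e0 = {u0, v0}" using is_immersion_path[OF imm e0(1)] .
  then have u0: "u0 \<in> ends H e0" "u0 \<in> verts H"
    using H(2) e0(1) by (auto simp: multigraph_def)
  have "u0 \<in> S" using side[OF e0] ends_sub[OF e0(1)] u0 by (auto simp: S_def)
  \<comment> \<open>\<open>path_within_side\<close> is now applied in \<open>H\<close> itself, where
    \<open>S\<close> has an empty cut.\<close>
  have S: "w \<in> S" if w: "w \<in> verts H" for w
  proof -
    obtain p where p: "path_between H u0 p w"
      using H(1) u0 w unfolding connected_graph_def by blast
    have "path_verts p \<subseteq> S"
      by (rule path_within_side[OF p]) (use path_between_in_verts[OF p] \<open>u0 \<in> S\<close>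
        \<open>boundary H S = {}\<close> in auto)
    then show ?thesis using path_between_in_verts[OF p] by auto
  qed
  have verts_side: "path_verts (\<psi> e) \<subseteq> D" if e: "e \<in> edges H" for e
  proof -
    obtain u v where uv: "ends H e = {u, v}" "path_between G (\<phi> u) (\<psi> e) (\<phi> v)"
      using is_immersion_path[OF imm e] .
    have "u \<in> verts H" using H(2) e uv by (auto simp: multigraph_def)
    then have "\<phi> u \<in> D" using S by (auto simp: S_def)
    then show ?thesis using side[OF e] path_between_in_verts[OF uv(2)] by auto
  qed
  show ?thesis
  proof (rule is_immersion_transfer[OF imm])
    show "\<phi> ` verts H \<subseteq> verts (induced_subgraph G D)"
      using imm S by (auto simp: is_immersion_def S_def)
    fix e assume e: "e \<in> edges H"
    obtain u v where p: "path_between G (\<phi> u) (\<psi> e) (\<phi> v)"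
      using is_immersion_path[OF imm e] .
    show "path_verts (\<psi> e) \<subseteq> verts (induced_subgraph G D)"
      using verts_side[OF e] path_between_in_verts[OF p] by auto
    show "path_edges (\<psi> e) \<subseteq> edges (induced_subgraph G D)"
      using verts_side[OF e] path_between_edge_ends[OF p] by fastforce
  qed simp
qed

section \<open>Packings and covers\<close>

definition is_packing :: "('a, 'b) mgraph \<Rightarrow> ('v, 'e) mgraph \<Rightarrow> ('v, 'e) mgraph set \<Rightarrow> bool" where
  "is_packing H G \<S> \<longleftrightarrow> \<S> \<subseteq> immersion_expansions H G \<and>
     (\<forall>S\<in>\<S>. \<forall>S'\<in>\<S>. S \<noteq> S' \<longrightarrow> edges S \<inter> edges S' = {})"

lemma pack_eq_Max: "pack H G = Max (card ` {\<S>. is_packing H G \<S>})"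
  unfolding pack_def is_packing_def by (rule arg_cong[where f = Max]) (rule setcompr_eq_image)

lemma edges_expansion_of [simp]:
  "edges (expansion_of H G \<phi> \<psi>) = (\<Union>e\<in>edges H. path_edges (\<psi> e))"
  by (simp add: expansion_of_def)

text \<open>\<open>expansion_of\<close> overwrites the vertex and edge sets and inherits only the
  incidence function. Packings found after a deletion can therefore be compared directly with
  packings of \<open>G\<close>.\<close>

lemma expansion_of_delete_edges [simp]:
  "expansion_of H (delete_edges G C) \<phi> \<psi> = expansion_of H G \<phi> \<psi>"
  by (simp add: expansion_of_def delete_edges_def)

text \<open>Incidence being inherited from \<open>G\<close>, an expansion is determined by its
  vertex set and its edge set.\<close>

lemma finite_immersion_expansions:
  assumes "multigraph G"
  shows "finite (immersion_expansions H G)"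
proof (rule finite_subset)
  show "immersion_expansions H G \<subseteq>
    (\<lambda>(A, B). G\<lparr>verts := A, edges := B\<rparr>) ` (Pow (verts G) \<times> Pow (edges G))"
  proof
    fix S assume "S \<in> immersion_expansions H G"
    then obtain \<phi> \<psi> where S: "S = expansion_of H G \<phi> \<psi>" and imm: "is_immersion H G \<phi> \<psi>"
      by (auto simp: immersion_expansions_def)
    have "path_verts (\<psi> e) \<subseteq> verts G" "path_edges (\<psi> e) \<subseteq> edges G" if "e \<in> edges H" for e
      using is_immersion_path[OF imm that] path_between_in_verts(3) path_between_edge_ends(2)
      by (metis subsetI)+
    moreover have "\<phi> ` verts H \<subseteq> verts G" using imm by (simp add: is_immersion_def)
    ultimately show "S \<in> (\<lambda>(A, B). G\<lparr>verts := A, edges := B\<rparr>) ` (Pow (verts G) \<times> Pow (edges G))"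
      unfolding S expansion_of_def
      by (intro image_eqI[of _ _ "(\<phi> ` verts H \<union> (\<Union>e\<in>edges H. path_verts (\<psi> e)), \<Union>e\<in>edges H. path_edges (\<psi> e))"])
        auto
  qed
qed (use assms in \<open>auto simp: multigraph_def\<close>)

text \<open>Finiteness makes \<open>Max\<close> a genuine maximum, and the empty packing makes its
  range nonempty.\<close>

lemma
  assumes "multigraph G"
  shows card_packing_le_pack: "is_packing H G \<S> \<Longrightarrow> card \<S> \<le> pack H G"
    and maximum_packing: "\<exists>\<S>. is_packing H G \<S> \<and> card \<S> = pack H G"
proof -
  let ?P = "{\<S>. is_packing H G \<S>}"
  have "finite ?P"
    by (rule finite_subset[of _ "Pow (immersion_expansions H G)"])
      (use finite_immersion_expansions[OF assms, of H] in \<open>auto simp: is_packing_def\<close>)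
  then have fin: "finite (card ` ?P)" by simp
  have "{} \<in> ?P" by (simp add: is_packing_def)
  then have "Max (card ` ?P) \<in> card ` ?P" using fin by (intro Max_in) auto
  then show "\<exists>\<S>. is_packing H G \<S> \<and> card \<S> = pack H G" unfolding pack_eq_Max by force
  show "card \<S> \<le> pack H G" if "is_packing H G \<S>"
    unfolding pack_eq_Max using fin that by (intro Max_ge) auto
qed

text \<open>An edge of \<open>H\<close> has two distinct ends and \<phi> keeps them distinct, so the
  path cannot be a single vertex.\<close>

lemma immersion_has_edge:
  assumes "multigraph H" "is_immersion H G \<phi> \<psi>" "e \<in> edges H"
  shows "path_edges (\<psi> e) \<noteq> {}"
proof
  assume empty: "path_edges (\<psi> e) = {}"
  obtain u v where uv: "ends H e = {u, v}" "path_between G (\<phi> u) (\<psi> e) (\<phi> v)"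
    using is_immersion_path[OF assms(2,3)] .
  have "\<phi> u = \<phi> v"
    using uv(2) empty by (auto simp: path_between_def path_edges_def length_Suc_conv)
  moreover have "u \<in> verts H" "v \<in> verts H" "u \<noteq> v"
    using assms(1,3) uv(1) by (auto simp: multigraph_def)
  ultimately show False using assms(2) by (auto simp: is_immersion_def inj_on_def)
qed

text \<open>The given expansion can be added to a maximum packing of the graph left after the
  deletion.\<close>

lemma pack_delete_edges_less:
  assumes G: "multigraph G" and H: "multigraph H" "edges H \<noteq> {}"
    and imm: "is_immersion H G \<phi> \<psi>"
    and disj: "\<And>\<phi>' \<psi>'. is_immersion H (delete_edges G C) \<phi>' \<psi>' \<Longrightarrow>
      (\<Union>e\<in>edges H. path_edges (\<psi> e)) \<inter> (\<Union>e\<in>edges H. path_edges (\<psi>' e)) = {}"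
  shows "pack H (delete_edges G C) < pack H G"
proof -
  obtain \<S> where \<S>: "is_packing H (delete_edges G C) \<S>" "card \<S> = pack H (delete_edges G C)"
    using maximum_packing[OF multigraph_delete_edges[OF G], of H] by blast
  let ?M = "expansion_of H G \<phi> \<psi>"
  have sub: "immersion_expansions H (delete_edges G C) \<subseteq> immersion_expansions H G"
    unfolding immersion_expansions_def
    using is_immersion_mono[of H "delete_edges G C" _ _ G] by fastforce
  have M: "?M \<in> immersion_expansions H G"
    using imm by (auto simp: immersion_expansions_def)
  have d: "edges ?M \<inter> edges S = {}" if S: "S \<in> \<S>" for S
  proof -
    obtain \<phi>' \<psi>' where "S = expansion_of H G \<phi>' \<psi>'" "is_immersion H (delete_edges G C) \<phi>' \<psi>'"
      using S \<S>(1) by (auto simp: immersion_expansions_def is_packing_def)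
    then show ?thesis using disj by simp
  qed
  \<comment> \<open>Without an edge, the expansion would be disjoint from itself and might already
    belong to \<open>\<S>\<close>.\<close>
  have "edges ?M \<noteq> {}" using immersion_has_edge[OF H(1) imm] H(2) by auto
  then have "?M \<notin> \<S>" using d by blast
  moreover have "is_packing H G (insert ?M \<S>)"
    using \<S>(1) sub M d unfolding is_packing_def by blast
  then have "card (insert ?M \<S>) \<le> pack H G" by (rule card_packing_le_pack[OF G])
  moreover have "finite \<S>"
    using \<S>(1) finite_immersion_expansions[OF multigraph_delete_edges[OF G], of H]
      finite_subset unfolding is_packing_def by blast
  ultimately show ?thesis using \<S>(2) by simp
qed

section \<open>Separating one expansion from all others\<close>

text \<open>The value at 0 accounts for the \<open>Suc\<close>; every further value first occurs at
  a change, and changes happen only at positive indices satisfying \<open>P\<close>.\<close>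

lemma card_image_le_changes:
  fixes \<tau> :: "nat \<Rightarrow> 'k"
  assumes "\<And>j. Suc j < n \<Longrightarrow> \<tau> (Suc j) \<noteq> \<tau> j \<Longrightarrow> P (Suc j)"
  shows "card (\<tau> ` {..<n}) \<le> Suc (card {j. 0 < j \<and> j < n \<and> P j})"
  using assms
proof (induction n)
  case (Suc n)
  have IH: "card (\<tau> ` {..<n}) \<le> Suc (card {j. 0 < j \<and> j < n \<and> P j})"
    using Suc by simp
  have fin: "finite {j. 0 < j \<and> j < Suc n \<and> P j}" by simp
  show ?case
  proof (cases n)
    case 0
    then show ?thesis by (simp add: lessThan_Suc)
  next
    case (Suc m)
    show ?thesis
    proof (cases "\<tau> n = \<tau> m")
      case True
      then have "\<tau> ` {..<Suc n} = \<tau> ` {..<n}"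
        using Suc by (auto simp: lessThan_Suc)
      then have "card (\<tau> ` {..<Suc n}) = card (\<tau> ` {..<n})" by (rule arg_cong)
      moreover have "card {j. 0 < j \<and> j < n \<and> P j} \<le> card {j. 0 < j \<and> j < Suc n \<and> P j}"
        by (rule card_mono[OF fin]) auto
      ultimately show ?thesis using IH by linarith
    next
      case False
      then have "P n" using Suc.prems[of m] Suc by simp
      then have "{j. 0 < j \<and> j < Suc n \<and> P j} = insert n {j. 0 < j \<and> j < n \<and> P j}"
        using Suc by auto
      moreover have "card (\<tau> ` {..<Suc n}) \<le> Suc (card (\<tau> ` {..<n}))"
        by (simp add: lessThan_Suc card_insert_le_m1 card_insert_if)
      ultimately show ?thesis using IH by simp
    qed
  qed
qed simp

lemma card_Union_le:
  assumes "\<And>K. K \<in> \<K> \<Longrightarrow> card K \<le> r" "card \<K> \<le> m" "finite \<K>"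
  shows "card (\<Union>\<K>) \<le> r * m"
proof -
  have "card (\<Union>\<K>) \<le> (\<Sum>K\<in>\<K>. card K)" using card_Union_le_sum_card .
  also have "\<dots> \<le> card \<K> * r" using sum_bounded_above[of \<K> card r] assms(1) by simp
  also have "\<dots> \<le> r * m" using assms(2) by (simp add: mult.commute)
  finally show ?thesis .
qed

text \<open>The tree is abstracted away: \<open>B\<close> plays the chosen bag and
  \<open>\<D>\<close> the vertex sets of the branches at its children. Each path accounts for at
  most \<open>r + 1\<close> deleted sets of at most \<open>r\<close> edges; \<open>1 \<le> r\<close>
  covers the singletons.\<close>

lemma separating_edge_set:
  assumes G: "multigraph G" and H: "multigraph H" "connected_graph H" "edges H \<noteq> {}"
    and r: "1 \<le> r" and B: "finite B" "card B \<le> r"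
    and dB: "\<And>D. D \<in> \<D> \<Longrightarrow> D \<inter> B = {}" and dD: "disjoint \<D>"
    and bd: "\<And>D. D \<in> \<D> \<Longrightarrow> card (boundary G D) \<le> r"
    and noH: "\<And>D. D \<in> \<D> \<Longrightarrow> \<not> contains_immersion (induced_subgraph G D) H"
    and nbr: "\<And>D e. D \<in> \<D> \<Longrightarrow> e \<in> edges G \<Longrightarrow> ends G e \<inter> D \<noteq> {} \<Longrightarrow> ends G e \<subseteq> D \<union> B"
    and cont: "contains_immersion (induced_subgraph G (B \<union> \<Union>\<D>)) H"
  shows "\<exists>C. C \<subseteq> edges G \<and> card C \<le> r * (r + 1) * card (edges H) \<and>
    pack H (delete_edges G C) < pack H G"
proof -
  let ?W = "B \<union> \<Union>\<D>"
  obtain \<phi> \<psi> where immW: "is_immersion H (induced_subgraph G ?W) \<phi> \<psi>"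
    using cont by (auto simp: contains_immersion_def)
  have imm: "is_immersion H G \<phi> \<psi>" by (rule is_immersion_mono[OF immW]) auto
  \<comment> \<open>\<open>\<kappa> e\<close> is what is deleted on account of the edge \<open>e\<close> of the expansion. Along a path it can change
    only at vertices of \<open>B\<close>, which bounds the number of its values.\<close>
  define \<kappa> where "\<kappa> e = (if ends G e \<subseteq> B then {e}
    else boundary G (SOME D. D \<in> \<D> \<and> ends G e \<inter> D \<noteq> {}))" for e
  \<comment> \<open>By \<open>nbr\<close> an edge meeting \<open>D\<close> has its other end in
    \<open>D\<close> or \<open>B\<close>, so it meets no second branch and the choice made by
    \<open>SOME\<close> is forced.\<close>
  have \<kappa>_D: "\<kappa> e = boundary G D"
    if e: "e \<in> edges G" "ends G e \<subseteq> ?W" and D: "D \<in> \<D>" "ends G e \<inter> D \<noteq> {}" for e D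
  proof -
    have uniq: "D' = D" if D': "D' \<in> \<D> \<and> ends G e \<inter> D' \<noteq> {}" for D'
    proof (rule ccontr)
      assume "D' \<noteq> D"
      then have "D \<inter> D' = {}" using dD D D' by (auto simp: disjoint_def)
      then show False using nbr[OF D(1) e(1) D(2)] dB D' by blast
    qed
    have "(SOME D. D \<in> \<D> \<and> ends G e \<inter> D \<noteq> {}) = D"
      by (rule some_equality) (use D uniq in blast)+
    moreover have "\<not> ends G e \<subseteq> B" using D dB by blast
    ultimately show ?thesis by (simp add: \<kappa>_def)
  qed
  have card_\<kappa>: "card (\<kappa> e) \<le> r \<and> \<kappa> e \<subseteq> edges G" if e: "e \<in> edges G" "ends G e \<subseteq> ?W" for e
  proof (cases "ends G e \<subseteq> B")
    case False
    then obtain D where "D \<in> \<D>" "ends G e \<inter> D \<noteq> {}" using e by blast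
    then show ?thesis using \<kappa>_D[OF e] bd by (auto simp: boundary_def)
  qed (use r e in \<open>auto simp: \<kappa>_def\<close>)
  have pW: "e \<in> edges G \<and> ends G e \<subseteq> ?W" if "h \<in> edges H" "e \<in> path_edges (\<psi> h)" for h e
    using is_immersion_path[OF immW that(1)] path_between_edge_ends(2) that(2)
    by (metis (no_types, lifting) induced_subgraph_simps(2) mem_Collect_eq)
  define C where "C = (\<Union>h\<in>edges H. \<Union>(\<kappa> ` path_edges (\<psi> h)))"
  have card_path: "card (\<Union>(\<kappa> ` path_edges (\<psi> h))) \<le> r * (r + 1)" if h: "h \<in> edges H" for h
  proof (rule card_Union_le)
    obtain vs es where \<psi>: "\<psi> h = (vs, es)" by (cases "\<psi> h")
    have pe: "path_edges (\<psi> h) = (\<lambda>i. es ! i) ` {..<length es}"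
      by (auto simp: \<psi> path_edges_def in_set_conv_nth image_iff)
    obtain u v where "path_between G (\<phi> u) (\<psi> h) (\<phi> v)"
      using is_immersion_path[OF imm h] .
    then have p: "length vs = length es + 1" "distinct vs"
        "\<And>i. i < length es \<Longrightarrow> ends G (es ! i) = {vs ! i, vs ! Suc i}"
      by (auto simp: \<psi> path_between_def)
    show "finite (\<kappa> ` path_edges (\<psi> h))" by (simp add: \<psi> path_edges_def)
    show "card K \<le> r" if "K \<in> \<kappa> ` path_edges (\<psi> h)" for K
      using that card_\<kappa> pW[OF h] by blast
    \<comment> \<open>For these \<open>j\<close>, \<open>vs ! j\<close> is the inner vertex shared
      by \<open>es ! (j - 1)\<close> and \<open>es ! j\<close>; the two ends of the path cause no
      change.\<close>
    let ?J = "{j. 0 < j \<and> j < length es \<and> vs ! j \<in> B}"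
    have "card (\<kappa> ` path_edges (\<psi> h)) = card ((\<lambda>i. \<kappa> (es ! i)) ` {..<length es})"
      by (simp add: pe image_image)
    also have "\<dots> \<le> Suc (card ?J)"
    proof (rule card_image_le_changes, rule ccontr)
      fix j assume j: "Suc j < length es" and ne: "\<kappa> (es ! Suc j) \<noteq> \<kappa> (es ! j)"
        and nB: "vs ! Suc j \<notin> B"
      have in_p: "es ! j \<in> path_edges (\<psi> h)" "es ! Suc j \<in> path_edges (\<psi> h)"
        using j by (auto simp: pe)
      have v: "vs ! Suc j \<in> ends G (es ! j)" "vs ! Suc j \<in> ends G (es ! Suc j)"
        using p(3)[of j] p(3)[of "Suc j"] j by auto
      \<comment> \<open>The shared vertex lies outside \<open>B\<close>, hence in a branch that both
        edges meet, and they get the same value of \<kappa>.\<close>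
      then obtain D where "D \<in> \<D>" "vs ! Suc j \<in> D"
        using pW[OF h in_p(1)] nB by blast
      then have "\<kappa> (es ! j) = boundary G D" "\<kappa> (es ! Suc j) = boundary G D"
        using v pW[OF h in_p(1)] pW[OF h in_p(2)] \<kappa>_D[of "es ! j" D] \<kappa>_D[of "es ! Suc j" D]
        by blast+
      then show False using ne by simp
    qed
    \<comment> \<open>The vertices of a path are distinct, so each vertex of \<open>B\<close> is
      visited at most once.\<close>
    also have "card ?J \<le> card B"
    proof (rule card_inj_on_le)
      show "inj_on (\<lambda>j. vs ! j) ?J" using p by (auto simp: inj_on_def nth_eq_iff_index_eq)
    qed (use B in auto)
    finally show "card (\<kappa> ` path_edges (\<psi> h)) \<le> r + 1" using B(2) by simp
  qed
  have finH: "finite (edges H)" using H by (simp add: multigraph_def)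
  have "card C \<le> (\<Sum>h\<in>edges H. card (\<Union>(\<kappa> ` path_edges (\<psi> h))))"
    unfolding C_def by (rule card_UN_le[OF finH])
  also have "\<dots> \<le> card (edges H) * (r * (r + 1))"
    using sum_bounded_above[of "edges H" "\<lambda>h. card (\<Union>(\<kappa> ` path_edges (\<psi> h)))"] card_path by simp
  finally have "card C \<le> r * (r + 1) * card (edges H)" by (simp add: mult.commute)
  moreover have "C \<subseteq> edges G" using card_\<kappa> pW unfolding C_def by blast
  moreover have "pack H (delete_edges G C) < pack H G"
  proof (rule pack_delete_edges_less[OF G H(1,3) imm], rule ccontr)
    fix \<phi>' \<psi>' assume imm': "is_immersion H (delete_edges G C) \<phi>' \<psi>'"
      and "(\<Union>e\<in>edges H. path_edges (\<psi> e)) \<inter> (\<Union>e\<in>edges H. path_edges (\<psi>' e)) \<noteq> {}"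
    then obtain e h h' where h: "h \<in> edges H" "e \<in> path_edges (\<psi> h)"
      and h': "h' \<in> edges H" "e \<in> path_edges (\<psi>' h')" by blast
    have avoid: "path_edges (\<psi>' g) \<inter> C = {}" if "g \<in> edges H" for g
      using is_immersion_path[OF imm' that] path_between_edge_ends(2)
      by (metis DiffD2 delete_edges_simps(2) disjoint_iff)
    have eC: "e \<notin> C" using avoid h' by blast
    have \<kappa>C: "\<kappa> e \<subseteq> C" using h unfolding C_def by blast
    have eG: "e \<in> edges G" "ends G e \<subseteq> ?W" using pW[OF h] by auto
    \<comment> \<open>A bag edge on the first expansion is itself deleted. The surviving
      \<open>e\<close> must therefore meet a branch, and the whole cut of that branch is in
      \<open>C\<close>.\<close>
    have "\<not> ends G e \<subseteq> B" using eC \<kappa>C by (auto simp: \<kappa>_def)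
    then obtain D where D: "D \<in> \<D>" "ends G e \<inter> D \<noteq> {}" using eG by blast
    have bC: "boundary G D \<subseteq> C" using \<kappa>C \<kappa>_D[OF eG D] by simp
    have imm'G: "is_immersion H G \<phi>' \<psi>'" by (rule is_immersion_mono[OF imm']) auto
    obtain u v where "path_between G (\<phi>' u) (\<psi>' h') (\<phi>' v)"
      using is_immersion_path[OF imm'G h'(1)] .
    then have "path_verts (\<psi>' h') \<inter> D \<noteq> {}"
      using path_between_edge_ends(1) h'(2) D(2) by fast
    \<comment> \<open>The second expansion meets \<open>D\<close> but avoids its cut, so it is
      confined to \<open>D\<close>, where \<open>H\<close> is excluded.\<close>
    then have "is_immersion H (induced_subgraph G D) \<phi>' \<psi>'"
      using avoid bC by (intro immersion_within_side[OF H(2,1) imm'G h'(1)]) blast+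
    then show False using noH[OF D(1)] by (auto simp: contains_immersion_def)
  qed
  ultimately show ?thesis by blast
qed

section \<open>Rooted tree-partitions\<close>

text \<open>The function \<open>depth\<close> need only decrease towards the root; it serves as a termination measure.\<close>

definition rooted_partition ::
  "('v, 'e) mgraph \<Rightarrow> 'n set \<Rightarrow> 'n \<Rightarrow> ('n \<Rightarrow> 'n) \<Rightarrow> ('n \<Rightarrow> nat) \<Rightarrow> ('n \<Rightarrow> 'v set) \<Rightarrow> nat \<Rightarrow> bool" where
  "rooted_partition G N \<rho> par depth X r \<longleftrightarrow> finite N \<and> \<rho> \<in> N \<and>
     (\<forall>t\<in>N - {\<rho>}. par t \<in> N \<and> depth (par t) < depth t) \<and>
     (\<Union>t\<in>N. X t) = verts G \<and> disjoint_family_on X N \<and> (\<forall>t\<in>N. card (X t) \<le> r) \<and>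
     (\<forall>e\<in>edges G. (\<exists>t\<in>N. ends G e \<subseteq> X t) \<or> (\<exists>t\<in>N - {\<rho>}. ends G e \<subseteq> X t \<union> X (par t))) \<and>
     (\<forall>t\<in>N - {\<rho>}. card {e \<in> edges G. ends G e \<inter> X t \<noteq> {} \<and> ends G e \<inter> X (par t) \<noteq> {}} \<le> r)"

text \<open>All width conditions are upper bounds, so the same nodes and bags can be reused with the
  same \<open>r\<close> throughout the later induction.\<close>

lemma rooted_partition_delete_edges:
  assumes "rooted_partition G N \<rho> par depth X r" "multigraph G"
  shows "rooted_partition (delete_edges G C) N \<rho> par depth X r"
proof -
  have "card {e \<in> edges G - C. P e} \<le> card {e \<in> edges G. P e}" for P
    using assms(2) by (intro card_mono) (auto simp: multigraph_def)
  then show ?thesis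
    using assms(1) unfolding rooted_partition_def by (fastforce intro: order_trans)
qed

text \<open>Supplies the hypotheses of \<open>separating_edge_set\<close> for a bag
  \<open>X t\<close>, where \<open>depth t\<close> is maximal among the nodes whose branch contains
  \<open>H\<close>. Uniqueness of parents and the decrease of \<open>depth\<close> make the branches
  at the children of \<open>t\<close> disjoint from each other and from \<open>X t\<close>.\<close>

lemma rooted_partition_separating_edge_set:
  assumes rp: "rooted_partition G N \<rho> par depth X r"
    and G: "multigraph G" and H: "multigraph H" "connected_graph H" "edges H \<noteq> {}"
    and r: "1 \<le> r" and cont: "contains_immersion G H"
  shows "\<exists>C. C \<subseteq> edges G \<and> card C \<le> r * (r + 1) * card (edges H) \<and>
    pack H (delete_edges G C) < pack H G"
proof -
  have N: "finite N" "\<rho> \<in> N" and par: "\<And>t. t \<in> N - {\<rho>} \<Longrightarrow> par t \<in> N \<and> depth (par t) < depth t"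
    and X: "(\<Union>t\<in>N. X t) = verts G" "disjoint_family_on X N" "\<And>t. t \<in> N \<Longrightarrow> card (X t) \<le> r"
    and edge: "\<And>e. e \<in> edges G \<Longrightarrow>
      (\<exists>t\<in>N. ends G e \<subseteq> X t) \<or> (\<exists>t\<in>N - {\<rho>}. ends G e \<subseteq> X t \<union> X (par t))"
    and cross: "\<And>t. t \<in> N - {\<rho>} \<Longrightarrow>
      card {e \<in> edges G. ends G e \<inter> X t \<noteq> {} \<and> ends G e \<inter> X (par t) \<noteq> {}} \<le> r"
    using rp unfolding rooted_partition_def by auto
  \<comment> \<open>\<open>R\<close> points from a node to its parent, so \<open>desc t\<close> is
    the subtree at \<open>t\<close>, including \<open>t\<close>; \<open>V t\<close> is the part of
    \<open>G\<close> in its bags and \<open>ch t\<close> the set of children.\<close>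
  define R where "R = {(t, par t) |t. t \<in> N - {\<rho>}}"
  define desc where "desc t = {s \<in> N. (s, t) \<in> R\<^sup>*}" for t
  define V where "V t = (\<Union>s\<in>desc t. X s)" for t
  define ch where "ch t = {c \<in> N - {\<rho>}. par c = t}" for t
  have depth_R: "depth t \<le> depth s" if "(s, t) \<in> R\<^sup>*" for s t
    using that by induction (use par in \<open>force simp: R_def\<close>)+
  have X_eq: "s = t" if "s \<in> N" "t \<in> N" "v \<in> X s" "v \<in> X t" for s t v
    using X(2) that by (auto simp: disjoint_family_on_def)
  have desc_sub: "desc t \<subseteq> N" for t by (auto simp: desc_def)
  have par_desc: "par s \<in> desc t" if st: "s \<in> desc t" "s \<noteq> t" for s t
  proof -
    have "(s, t) \<in> R\<^sup>*" using st by (auto simp: desc_def)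
    then obtain y where "(s, y) \<in> R" "(y, t) \<in> R\<^sup>*" using st(2) by (meson converse_rtranclE)
    then show ?thesis using par by (auto simp: desc_def R_def)
  qed
  have desc_par: "s \<in> desc t" if "par s \<in> desc t" "s \<in> N - {\<rho>}" for s t
    using that by (auto simp: desc_def R_def intro: converse_rtrancl_into_rtrancl)
  have root: "desc \<rho> = N"
  proof -
    have "s \<in> desc \<rho>" if "s \<in> N" for s
      using that
    proof (induction "depth s" arbitrary: s rule: less_induct)
      case less
      show ?case
      proof (cases "s = \<rho>")
        case False
        then show ?thesis using less par desc_par by blast
      qed (use N in \<open>auto simp: desc_def\<close>)
    qed
    then show ?thesis using desc_sub by blast
  qed
  let ?Q = "\<lambda>t. t \<in> N \<and> contains_immersion (induced_subgraph G (V t)) H"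
  have "induced_subgraph G (V \<rho>) = G"
  proof -
    have "V \<rho> = verts G" using X root by (simp add: V_def)
    moreover have "{e \<in> edges G. ends G e \<subseteq> verts G} = edges G"
      using G by (auto simp: multigraph_def)
    ultimately show ?thesis by (simp add: induced_subgraph_def)
  qed
  then have Q\<rho>: "?Q \<rho>" using N cont by simp
  \<comment> \<open>The existence of a maximum is derived from a strict upper bound, hence the
    \<open>Suc\<close>.\<close>
  have "\<forall>s. ?Q s \<longrightarrow> depth s < Suc (Max (depth ` N))"
    using N(1) by (auto simp: less_Suc_eq_le)
  from ex_has_greatest_nat[of ?Q, OF Q\<rho> this]
  obtain t where t: "?Q t" and max: "\<And>s. ?Q s \<Longrightarrow> depth s \<le> depth t"
    by blast
  have tN: "t \<in> N" using t by simp
  have desc_split: "desc t = {t} \<union> (\<Union>c\<in>ch t. desc c)"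
  proof (intro equalityI subsetI)
    fix s assume s: "s \<in> desc t"
    show "s \<in> {t} \<union> (\<Union>c\<in>ch t. desc c)"
    proof (cases "s = t")
      case False
      have "(s, t) \<in> R\<^sup>*" using s by (simp add: desc_def)
      then obtain c where "(s, c) \<in> R\<^sup>*" "(c, t) \<in> R"
        using False by (meson rtranclE)
      then show ?thesis using s by (auto simp: desc_def ch_def R_def)
    qed simp
  next
    fix s assume "s \<in> {t} \<union> (\<Union>c\<in>ch t. desc c)"
    then show "s \<in> desc t"
      using tN by (auto simp: desc_def ch_def R_def intro: rtrancl_into_rtrancl)
  qed
  \<comment> \<open>If \<open>t\<close> were below its child \<open>c\<close>, then
    \<open>depth c \<le> depth t\<close>, whereas the parent \<open>t\<close> has the smaller
    depth.\<close>
  have ch_not_anc: "(t, c) \<notin> R\<^sup>*" if "c \<in> ch t" for c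
    using that depth_R[of t c] par by (force simp: ch_def)
  have sv: "single_valued R" by (auto simp: R_def single_valued_def)
  \<comment> \<open>The first step upwards from \<open>c\<close> leads to \<open>t\<close>, which is
    not below \<open>c'\<close>.\<close>
  have ch_R: "c = c'" if c: "c \<in> ch t" "c' \<in> ch t" "(c, c') \<in> R\<^sup>*" for c c'
  proof (rule ccontr)
    assume "c \<noteq> c'"
    then obtain y where "(c, y) \<in> R" "(y, c') \<in> R\<^sup>*" using c(3) by (meson converse_rtranclE)
    moreover have "y = t" using \<open>(c, y) \<in> R\<close> c(1) by (auto simp: R_def ch_def)
    ultimately show False using ch_not_anc[OF c(2)] by simp
  qed
  \<comment> \<open>Parents are unique, so two ancestors of \<open>s\<close> are comparable; by
    \<open>ch_R\<close> comparable children of \<open>t\<close> are equal.\<close>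
  have ch_desc: "c = c'" if "c \<in> ch t" "c' \<in> ch t" "s \<in> desc c" "s \<in> desc c'" for c c' s
    using single_valued_confluent[OF sv, of s c c'] ch_R that by (auto simp: desc_def)
  have V_split: "V t = X t \<union> \<Union>(V ` ch t)"
    unfolding V_def desc_split by auto
  \<comment> \<open>An edge of \<open>G\<close> meeting the branch of \<open>c\<close> lies in one
    bag or in \<open>X s \<union> X (par s)\<close> with \<open>s\<close> below \<open>c\<close>.
    Unless \<open>s = c\<close>, the node \<open>par s\<close> is below \<open>c\<close> as well,
    and the edge does not leave the branch.\<close>
  have leave: "ends G e \<subseteq> X c \<union> X t"
    if c: "c \<in> ch t" and e: "e \<in> boundary G (V c)" for c e
  proof -
    have eG: "e \<in> edges G" and eV: "ends G e \<inter> V c \<noteq> {}" "\<not> ends G e \<subseteq> V c"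
      using e by (auto simp: boundary_def)
    have in_V: "X s \<subseteq> V c" if "s \<in> desc c" for s using that by (auto simp: V_def)
    have in_desc: "s \<in> desc c" if "s \<in> N" "v \<in> X s" "v \<in> V c" for s v
      using that X_eq desc_sub by (fastforce simp: V_def)
    consider s where "s \<in> N" "ends G e \<subseteq> X s" | s where "s \<in> N - {\<rho>}" "ends G e \<subseteq> X s \<union> X (par s)"
      using edge[OF eG] by blast
    then show ?thesis
    proof cases
      case 1
      then have "s \<in> desc c" using eV(1) in_desc by blast
      then show ?thesis using in_V 1 eV(2) by blast
    next
      case 2
      then have "par s \<in> N" using par by blast
      then have "s \<in> desc c \<or> par s \<in> desc c" using eV(1) in_desc 2 by blast
      then have s: "s \<in> desc c" using desc_par 2 by blast
      have "s = c"
      proof (rule ccontr)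
        assume "s \<noteq> c"
        then have "par s \<in> desc c" using par_desc s by blast
        then show False using in_V s 2 eV(2) by blast
      qed
      then show ?thesis using 2 c by (simp add: ch_def)
    qed
  qed
  show ?thesis
  proof (rule separating_edge_set[OF G H r])
    show "finite (X t)"
      using X(1) tN G by (auto simp: multigraph_def intro: finite_subset)
    show "card (X t) \<le> r" using X(3) tN .
    show "contains_immersion (induced_subgraph G (X t \<union> \<Union>(V ` ch t))) H"
      using t V_split by simp
    show "disjoint (V ` ch t)"
    proof (rule disjointI)
      fix A B assume "A \<in> V ` ch t" "B \<in> V ` ch t" "A \<noteq> B"
      then obtain c c' where c: "c \<in> ch t" "c' \<in> ch t" "c \<noteq> c'" "A = V c" "B = V c'" by blast
      show "A \<inter> B = {}"
      proof (rule ccontr)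
        assume "A \<inter> B \<noteq> {}"
        then obtain v s s' where "s \<in> desc c" "s' \<in> desc c'" "v \<in> X s" "v \<in> X s'"
          using c by (auto simp: V_def)
        then show False using X_eq desc_sub ch_desc c by (metis subsetD)
      qed
    qed
    fix D assume "D \<in> V ` ch t"
    then obtain c where c: "c \<in> ch t" "D = V c" by blast
    show "D \<inter> X t = {}"
    proof (rule ccontr)
      assume "D \<inter> X t \<noteq> {}"
      then obtain s v where "s \<in> desc c" "v \<in> X s" "v \<in> X t" using c by (auto simp: V_def)
      then have "t \<in> desc c" using X_eq desc_sub tN by (metis subsetD)
      then show False using ch_not_anc c by (simp add: desc_def)
    qed
    \<comment> \<open>A child has greater depth than \<open>t\<close>, so maximality of
      \<open>t\<close> excludes it.\<close>
    show "\<not> contains_immersion (induced_subgraph G D) H"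
      using max[of c] par[of c] c by (force simp: ch_def)
    have "finite (edges G)" using G by (simp add: multigraph_def)
    \<comment> \<open>By \<open>leave\<close> a cut edge lies in \<open>X c \<union> X t\<close>.
      Its end in \<open>D\<close> is in \<open>X c\<close> because \<open>X t\<close> misses
      \<open>D\<close>; its end outside \<open>D\<close> is in \<open>X t\<close>, which is
      \<open>X (par c)\<close>.\<close>
    moreover have "boundary G D \<subseteq>
      {e \<in> edges G. ends G e \<inter> X c \<noteq> {} \<and> ends G e \<inter> X (par c) \<noteq> {}}"
    proof
      fix e assume e: "e \<in> boundary G D"
      have "X c \<subseteq> D" using c by (auto simp: V_def desc_def ch_def)
      then show "e \<in> {e \<in> edges G. ends G e \<inter> X c \<noteq> {} \<and> ends G e \<inter> X (par c) \<noteq> {}}"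
        using leave[of c e] e c \<open>D \<inter> X t = {}\<close> unfolding boundary_def ch_def by blast
    qed
    ultimately have "card (boundary G D) \<le>
      card {e \<in> edges G. ends G e \<inter> X c \<noteq> {} \<and> ends G e \<inter> X (par c) \<noteq> {}}"
      by (intro card_mono) auto
    then show "card (boundary G D) \<le> r"
      using cross[of c] c by (auto simp: ch_def)
    fix e assume "e \<in> edges G" "ends G e \<inter> D \<noteq> {}"
    moreover have "X c \<subseteq> D" using c by (auto simp: V_def desc_def ch_def)
    ultimately show "ends G e \<subseteq> D \<union> X t"
      using leave[of c e] c by (auto simp: boundary_def)
  qed
qed

lemma rooted_partition_edge_cover:
  assumes "rooted_partition G N \<rho> par depth X r"
    and "multigraph G" and H: "multigraph H" "connected_graph H" "edges H \<noteq> {}"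
    and r: "1 \<le> r"
  shows "\<exists>C. C \<subseteq> edges G \<and> card C \<le> r * (r + 1) * card (edges H) * pack H G \<and>
    \<not> contains_immersion (delete_edges G C) H"
  using assms(1,2)
proof (induction "pack H G" arbitrary: G rule: less_induct)
  case less
  let ?m = "r * (r + 1) * card (edges H)"
  show ?case
  proof (cases "contains_immersion G H")
    case True
    obtain C where C: "C \<subseteq> edges G" "card C \<le> ?m" "pack H (delete_edges G C) < pack H G"
      using rooted_partition_separating_edge_set[OF less.prems H r True] by blast
    obtain C' where C': "C' \<subseteq> edges G - C" "card C' \<le> ?m * pack H (delete_edges G C)"
      "\<not> contains_immersion (delete_edges G (C \<union> C')) H"
      using less.hyps[OF C(3) rooted_partition_delete_edges[OF less.prems]
        multigraph_delete_edges[OF less.prems(2)]] by auto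
    have "card (C \<union> C') \<le> card C + card C'" by (rule card_Un_le)
    also have "\<dots> \<le> ?m * Suc (pack H (delete_edges G C))" using C(2) C'(2) by simp
    \<comment> \<open>The packing number falls by at least one, which pays for the edges of
      \<open>C\<close>.\<close>
    also have "\<dots> \<le> ?m * pack H G" using C(3) by (intro mult_le_mono2) simp
    finally show ?thesis using C(1) C' by (intro exI[of _ "C \<union> C'"]) auto
  next
    case False
    then show ?thesis by (intro exI[of _ "{}"]) simp
  qed
qed

section \<open>Rooting a tree\<close>

definition adjacency :: "('v, 'e) mgraph \<Rightarrow> ('v \<times> 'v) set" where
  "adjacency G = {(u, v). \<exists>e\<in>edges G. ends G e = {u, v}}"

lemma path_between_imp_reachable:
  assumes "path_between G u p v"
  shows "(u, v) \<in> (adjacency G)\<^sup>*"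
proof -
  obtain vs es where p: "p = (vs, es)" by (cases p)
  have len: "length vs = length es + 1" and hd: "hd vs = u" and last: "last vs = v"
    and ends: "\<And>i. i < length es \<Longrightarrow> es ! i \<in> edges G \<and> ends G (es ! i) = {vs ! i, vs ! Suc i}"
    using assms by (auto simp: p path_between_def)
  have "(vs ! 0, vs ! i) \<in> (adjacency G)\<^sup>*" if "i \<le> length es" for i
    using that
  proof (induction i)
    case (Suc i)
    then have "(vs ! i, vs ! Suc i) \<in> adjacency G" using ends[of i] by (auto simp: adjacency_def)
    then show ?case using Suc by (simp add: rtrancl_into_rtrancl)
  qed simp
  moreover have "vs \<noteq> []" using len by auto
  ultimately show ?thesis using len hd last by (force simp: hd_conv_nth last_conv_nth)
qed

text \<open>The walk is shortened while it is built: if the next vertex is already on the path, the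
  path is cut off there, which keeps its vertices distinct.\<close>

lemma reachable_imp_path_between:
  assumes "(u, v) \<in> (adjacency G)\<^sup>*" "u \<in> verts G" "multigraph G"
  shows "\<exists>p. path_between G u p v"
  using assms(1)
proof induction
  case base
  show ?case using assms(2) by (intro exI[of _ "([u], [])"]) (simp add: path_between_def)
next
  case (step v w)
  then obtain vs es where p: "path_between G u (vs, es) v" by auto
  obtain e where e: "e \<in> edges G" "ends G e = {v, w}"
    using step by (auto simp: adjacency_def)
  have w: "w \<in> verts G" using e assms(3) by (auto simp: multigraph_def)
  have len: "length vs = length es + 1" and ne: "vs \<noteq> []" using p by (auto simp: path_between_def)
  show ?case
  proof (cases "w \<in> set vs")
    case True
    then obtain i where i: "i < length vs" "vs ! i = w" by (auto simp: in_set_conv_nth)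
    \<comment> \<open>An initial piece with \<open>i\<close> edges has \<open>Suc i\<close> vertices
      and ends in \<open>vs ! i\<close>.\<close>
    have "path_between G u (take (Suc i) vs, take i es) w"
      using p i len ne unfolding path_between_def
      by (auto simp: last_conv_nth hd_take dest: in_set_takeD)
    then show ?thesis ..
  next
    case False
    have "v = vs ! length es" using p len ne by (auto simp: path_between_def last_conv_nth)
    then have "path_between G u (vs @ [w], es @ [e]) w"
      using p e w False len ne unfolding path_between_def
      by (auto simp: nth_append less_Suc_eq)
    then show ?thesis ..
  qed
qed

text \<open>A path from \<open>a\<close> to \<open>b\<close> avoiding \<open>f\<close> would close
  up with \<open>f\<close> to a cycle.\<close>

lemma tree_edge_is_bridge:
  assumes T: "is_tree T" and f: "f \<in> edges T" "ends T f = {a, b}"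
  shows "(a, b) \<notin> (adjacency (delete_edges T {f}))\<^sup>*"
proof
  have mT: "multigraph T" using T by (simp add: is_tree_def)
  have ab: "a \<noteq> b" "a \<in> verts T" "b \<in> verts T" using mT f by (auto simp: multigraph_def)
  assume "(a, b) \<in> (adjacency (delete_edges T {f}))\<^sup>*"
  then obtain vs es where p: "path_between (delete_edges T {f}) a (vs, es) b"
    using reachable_imp_path_between[OF _ _ multigraph_delete_edges[OF mT]] ab by force
  have len: "length vs = length es + 1" and ne: "vs \<noteq> []" and dvs: "distinct vs"
    and hd: "hd vs = a" and last: "last vs = b"
    and ends: "\<And>i. i < length es \<Longrightarrow> ends T (es ! i) = {vs ! i, vs ! Suc i}"
    and es: "set es \<subseteq> edges T - {f}" and vs: "set vs \<subseteq> verts T"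
    using p by (auto simp: path_between_def)
  \<comment> \<open>This gives the closed walk the length at least 2 required of a cycle; length 2
    is the case of an edge parallel to \<open>f\<close>.\<close>
  have "es \<noteq> []" using len hd last ab by (auto simp: length_Suc_conv)
  \<comment> \<open>\<open>path_between\<close> demands distinct vertices only; a repeated edge
    would repeat a pair of consecutive vertices.\<close>
  have "distinct es"
    unfolding distinct_conv_nth
  proof (intro allI impI notI)
    fix i j assume ij: "i < length es" "j < length es" "i \<noteq> j" "es ! i = es ! j"
    then have "{vs ! i, vs ! Suc i} = {vs ! j, vs ! Suc j}" using ends by metis
    then show False using ij len dvs by (auto simp: doubleton_eq_iff nth_eq_iff_index_eq)
  qed
  \<comment> \<open>At \<open>i = length es\<close> the vertex index wraps around to 0, and
    \<open>f\<close> leads from \<open>b\<close> back to \<open>a\<close>.\<close>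
  have ends': "ends T ((es @ [f]) ! i) = {vs ! i, vs ! ((i + 1) mod length (es @ [f]))}"
    if "i < length (es @ [f])" for i
  proof (cases "i < length es")
    case True
    then show ?thesis using ends by (simp add: nth_append)
  next
    case False
    then have "i = length es" using that by simp
    then show ?thesis using f(2) hd last len ne
      by (simp add: hd_conv_nth last_conv_nth insert_commute)
  qed
  have "is_cycle T vs (es @ [f])"
    unfolding is_cycle_def using len dvs \<open>distinct es\<close> es vs f(1) \<open>es \<noteq> []\<close> ends'
    by (auto simp: Suc_le_eq)
  then show False using T by (auto simp: is_tree_def)
qed

text \<open>Any node can be the root. The depth is the length of a shortest walk to it, and the
  parent is a neighbour of smaller depth, which exists on such a walk. Acyclicity enters in the last
  claim, that all edges are parent edges.\<close>

lemma tree_rooting: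
  assumes T: "is_tree T"
  obtains \<rho> par and depth :: "'n \<Rightarrow> nat"
  where "\<rho> \<in> verts T"
    and "\<And>t. t \<in> verts T - {\<rho>} \<Longrightarrow>
      par t \<in> verts T \<and> depth (par t) < depth t \<and> (\<exists>f\<in>edges T. ends T f = {t, par t})"
    and "\<And>f. f \<in> edges T \<Longrightarrow> \<exists>t\<in>verts T - {\<rho>}. ends T f = {t, par t}"
proof -
  have mT: "multigraph T" and conn: "connected_graph T" using T by (auto simp: is_tree_def)
  obtain \<rho> where \<rho>: "\<rho> \<in> verts T" using conn by (auto simp: connected_graph_def)
  let ?A = "adjacency T"
  have A_verts: "s \<in> verts T" if "(t, s) \<in> ?A" for s t
    using that mT by (auto simp: adjacency_def multigraph_def)
  define depth where "depth t = (LEAST n. (t, \<rho>) \<in> ?A ^^ n)" for t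
  have "\<exists>s. (t, s) \<in> ?A \<and> depth s < depth t" if t: "t \<in> verts T - {\<rho>}" for t
  proof -
    have "(t, \<rho>) \<in> ?A\<^sup>*"
      using conn t \<rho> path_between_imp_reachable by (fastforce simp: connected_graph_def)
    then obtain n where "(t, \<rho>) \<in> ?A ^^ n" by (meson rtrancl_imp_relpow)
    then have d: "(t, \<rho>) \<in> ?A ^^ depth t" unfolding depth_def by (rule LeastI)
    with t obtain m where m: "depth t = Suc m" by (cases "depth t") auto
    then obtain s where s: "(t, s) \<in> ?A" "(s, \<rho>) \<in> ?A ^^ m" using d by (metis relpow_Suc_D2)
    have "depth s \<le> m" unfolding depth_def using s(2) by (rule Least_le)
    then show ?thesis using s m by auto
  qed
  then obtain par where par: "\<And>t. t \<in> verts T - {\<rho>} \<Longrightarrow> (t, par t) \<in> ?A \<and> depth (par t) < depth t"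
    by metis
  show ?thesis
  proof (rule that[OF \<rho>])
    show "par t \<in> verts T \<and> depth (par t) < depth t \<and> (\<exists>f\<in>edges T. ends T f = {t, par t})"
      if "t \<in> verts T - {\<rho>}" for t
      using par[OF that] A_verts by (auto simp: adjacency_def)
    fix f assume f: "f \<in> edges T"
    show "\<exists>t\<in>verts T - {\<rho>}. ends T f = {t, par t}"
    proof (rule ccontr)
      assume no: "\<not> ?thesis"
      let ?A' = "adjacency (delete_edges T {f})"
      \<comment> \<open>If \<open>f\<close> is no parent edge, following parents leads every node to
        the root without \<open>f\<close>. Joining the walks from both ends of \<open>f\<close>
        contradicts that \<open>f\<close> is a bridge.\<close>
      have to_root: "(t, \<rho>) \<in> ?A'\<^sup>*" if "t \<in> verts T" for t
        using that
      proof (induction "depth t" arbitrary: t rule: less_induct)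
        case less
        show ?case
        proof (cases "t = \<rho>")
          case False
          then have t: "t \<in> verts T - {\<rho>}" using less by simp
          then obtain g where g: "g \<in> edges T" "ends T g = {t, par t}"
            using par by (auto simp: adjacency_def)
          then have "g \<noteq> f" using no t by auto
          then have "(t, par t) \<in> ?A'" using g by (auto simp: adjacency_def)
          moreover have "(par t, \<rho>) \<in> ?A'\<^sup>*" using less.hyps par[OF t] A_verts by blast
          ultimately show ?thesis by (rule converse_rtrancl_into_rtrancl)
        qed simp
      qed
      have "card (ends T f) = 2" "ends T f \<subseteq> verts T" using mT f by (auto simp: multigraph_def)
      then obtain a b where ab: "ends T f = {a, b}" "a \<in> verts T" "b \<in> verts T"
        by (auto simp: card_2_iff)
      have "sym ?A'" by (auto simp: sym_def adjacency_def insert_commute)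
      then have "(\<rho>, b) \<in> ?A'\<^sup>*" using to_root[OF ab(3)] by (meson sym_rtrancl symD)
      then have "(a, b) \<in> ?A'\<^sup>*" using to_root[OF ab(2)] by (rule rtrancl_trans[rotated])
      then show False using tree_edge_is_bridge[OF T f ab(1)] by simp
    qed
  qed
qed

text \<open>Every tree edge joins a node to its parent, so conditions indexed by tree edges become
  conditions indexed by the nodes other than the root. In a one-node tree every edge of
  \<open>G\<close> lies within the single bag.\<close>

lemma tree_partition_imp_rooted_partition:
  assumes G: "multigraph G" and tp: "tree_partition G T X"
  shows "\<exists>\<rho> par depth. rooted_partition G (verts T) \<rho> par depth X (tp_width G T X)"
proof -
  have T: "is_tree T" and X: "(\<Union>t\<in>verts T. X t) = verts G" "disjoint_family_on X (verts T)"
    and cases: "card (verts T) = 1 \<or>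
      (\<forall>e\<in>edges G. \<exists>f\<in>edges T. \<exists>t t'. ends T f = {t, t'} \<and> ends G e \<subseteq> X t \<union> X t')"
    using tp by (auto simp: tree_partition_def)
  have fin: "finite (verts T)" "finite (edges T)" using T by (auto simp: is_tree_def multigraph_def)
  have wX: "card (X t) \<le> tp_width G T X" if "t \<in> verts T" for t
    unfolding tp_width_def using fin that by (intro Max_ge) auto
  have wE: "card (cross_edges G T X f) \<le> tp_width G T X" if "f \<in> edges T" for f
    unfolding tp_width_def using fin that by (intro Max_ge) auto
  obtain \<rho> par and depth :: "'c \<Rightarrow> nat" where \<rho>: "\<rho> \<in> verts T"
    and par: "\<And>t. t \<in> verts T - {\<rho>} \<Longrightarrow>
      par t \<in> verts T \<and> depth (par t) < depth t \<and> (\<exists>f\<in>edges T. ends T f = {t, par t})"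
    and edge: "\<And>f. f \<in> edges T \<Longrightarrow> \<exists>t\<in>verts T - {\<rho>}. ends T f = {t, par t}"
    using tree_rooting[OF T] by metis
  have "(\<exists>t\<in>verts T. ends G e \<subseteq> X t) \<or> (\<exists>t\<in>verts T - {\<rho>}. ends G e \<subseteq> X t \<union> X (par t))"
    if eG: "e \<in> edges G" for e
    using cases
  proof
    assume "card (verts T) = 1"
    then obtain t where "verts T = {t}" by (auto simp: card_1_singleton_iff)
    moreover have "ends G e \<subseteq> verts G" using G eG by (auto simp: multigraph_def)
    ultimately show ?thesis using X(1) by auto
  next
    assume "\<forall>e\<in>edges G. \<exists>f\<in>edges T. \<exists>t t'. ends T f = {t, t'} \<and> ends G e \<subseteq> X t \<union> X t'"
    then obtain f t t' where f: "f \<in> edges T" "ends T f = {t, t'}" "ends G e \<subseteq> X t \<union> X t'"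
      using eG by blast
    obtain s where "s \<in> verts T - {\<rho>}" "{t, t'} = {s, par s}" using edge[OF f(1)] f(2) by auto
    then show ?thesis using f(3) by (auto simp: doubleton_eq_iff)
  qed
  moreover have "card {e \<in> edges G. ends G e \<inter> X t \<noteq> {} \<and> ends G e \<inter> X (par t) \<noteq> {}} \<le> tp_width G T X"
    if t: "t \<in> verts T - {\<rho>}" for t
  proof -
    obtain f where f: "f \<in> edges T" "ends T f = {t, par t}" using par[OF t] by blast
    have "par t \<noteq> t" using par[OF t] by auto
    then have disj: "X t \<inter> X (par t) = {}"
      using X(2) par[OF t] t by (auto simp: disjoint_family_on_def)
    \<comment> \<open>The two bags are disjoint, so an edge meeting both has exactly one end in
      each.\<close>
    have "{e \<in> edges G. ends G e \<inter> X t \<noteq> {} \<and> ends G e \<inter> X (par t) \<noteq> {}} \<subseteq> cross_edges G T X f"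
    proof
      fix e assume "e \<in> {e \<in> edges G. ends G e \<inter> X t \<noteq> {} \<and> ends G e \<inter> X (par t) \<noteq> {}}"
      then obtain u v where uv: "e \<in> edges G" "u \<in> ends G e" "v \<in> ends G e" "u \<in> X t" "v \<in> X (par t)"
        by blast
      moreover have "u \<noteq> v" using uv disj by auto
      moreover have "card (ends G e) = 2" using G uv(1) by (auto simp: multigraph_def)
      ultimately have "ends G e = {u, v}" by (auto simp: card_2_iff)
      then show "e \<in> cross_edges G T X f" using uv f by (auto simp: cross_edges_def)
    qed
    moreover have "finite (cross_edges G T X f)"
      using G by (auto simp: cross_edges_def multigraph_def)
    ultimately show ?thesis using wE[OF f(1)] card_mono order_trans by meson
  qed
  ultimately have "rooted_partition G (verts T) \<rho> par depth X (tp_width G T X)"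
    unfolding rooted_partition_def using fin \<rho> par X wX by auto
  then show ?thesis by blast
qed

section \<open>Attaining the minimum width, and the final estimate\<close>

lemma tpw_attained:
  "\<exists>(T :: (nat, nat) mgraph) X. tree_partition G T X \<and> tp_width G T X = tpw G"
proof -
  \<comment> \<open>The one-node tree with the single bag \<open>verts G\<close> shows that the
    \<open>LEAST\<close> in \<open>tpw\<close> ranges over a nonempty set.\<close>
  define T :: "(nat, nat) mgraph" where "T = \<lparr>verts = {0}, edges = {}, ends = \<lambda>_. {}\<rparr>"
  have "path_between T 0 ([0], []) 0" by (simp add: path_between_def T_def)
  then have "is_tree T"
    by (auto simp: is_tree_def multigraph_def connected_graph_def is_cycle_def T_def)
  then have "tree_partition G T (\<lambda>_. verts G)"
    by (auto simp: tree_partition_def disjoint_family_on_def T_def)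
  then have "\<exists>w (T :: (nat, nat) mgraph) X. tree_partition G T X \<and> tp_width G T X = w" by blast
  then show ?thesis unfolding tpw_def by (rule LeastI_ex)
qed

lemma cover_le:
  assumes "C \<subseteq> edges G" "\<not> contains_immersion (delete_edges G C) H"
  shows "cover H G \<le> card C"
  unfolding cover_def by (rule Least_le) (use assms in auto)

theorem theorem10:
  fixes H :: "('a, 'b) mgraph" and G :: "('v, 'e) mgraph"
  assumes "multigraph H" and "connected_graph H" and "edges H \<noteq> {}"
    and "multigraph G"
  shows "int (cover H G) \<le> omega H (tpw G) * int (pack H G)"
proof -
  let ?r = "tpw G" and ?h = "card (edges H)"
  obtain T :: "(nat, nat) mgraph" and X where "tree_partition G T X" "tp_width G T X = ?r"
    using tpw_attained[of G] by blast
  then obtain \<rho> par depth where rp: "rooted_partition G (verts T) \<rho> par depth X ?r"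
    using tree_partition_imp_rooted_partition[OF assms(4)] by metis
  show ?thesis
  proof (cases "1 \<le> ?r")
    case True
    obtain C where C: "C \<subseteq> edges G" "card C \<le> ?r * (?r + 1) * ?h * pack H G"
      "\<not> contains_immersion (delete_edges G C) H"
      using rooted_partition_edge_cover[OF rp assms(4,1-3) True] by blast
    \<comment> \<open>This inequality is equivalent to \<open>1 \<le> ?r\<close>; it is where the
      sharper factor \<open>?r + 1\<close> is weakened to the stated one.\<close>
    have "real ?r + 1 \<le> (3 * real ?r + 1) / 2" using True by simp
    then have "real ?r * (real ?r + 1) * real ?h \<le> real ?r * ((3 * real ?r + 1) / 2) * real ?h"
      by (intro mult_right_mono mult_left_mono) auto
    moreover have "real_of_int (int (?r * (?r + 1) * ?h)) = real ?r * (real ?r + 1) * real ?h"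
      by (simp add: algebra_simps)
    ultimately have "int (?r * (?r + 1) * ?h) \<le> omega H ?r"
      unfolding omega_def by linarith
    then have "int (?r * (?r + 1) * ?h) * int (pack H G) \<le> omega H ?r * int (pack H G)"
      by (rule mult_right_mono) simp
    moreover have "int (cover H G) \<le> int (?r * (?r + 1) * ?h) * int (pack H G)"
      using cover_le[OF C(1,3)] C(2) by (metis of_nat_le_iff of_nat_mult order_trans)
    ultimately show ?thesis by linarith
  next
    case False
    \<comment> \<open>Width 0 makes every bag empty, so \<open>G\<close> has no vertices and cannot
      host \<open>H\<close>, which has one.\<close>
    have "X t = {}" if t: "t \<in> verts T" for t
    proof -
      have "X t \<subseteq> verts G" "card (X t) \<le> ?r" using rp t by (auto simp: rooted_partition_def)
      moreover have "finite (verts G)" using assms(4) by (simp add: multigraph_def)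
      \<comment> \<open>\<open>card\<close> is 0 on infinite sets by default, so emptiness follows
        only together with finiteness.\<close>
      ultimately have "finite (X t)" "card (X t) = 0" using False by (auto intro: finite_subset)
      then show ?thesis by simp
    qed
    then have "verts G = {}" using rp by (auto simp: rooted_partition_def)
    then have "\<not> contains_immersion G H"
      using assms(2) by (auto simp: contains_immersion_def is_immersion_def connected_graph_def)
    then have "cover H G = 0" using cover_le[of "{}" G H] by simp
    moreover have "?r = 0" using False by simp
    then have "omega H ?r = 0" by (simp add: omega_def)
    ultimately show ?thesis by simp
  qed
qed

end
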